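(* Let $X$ be an $\mathbb R^d$-valued random vector with compactly supported distribution $\mathbb P_X$, defined on $(\Omega,\mathcal S,\mathbb P)$. Let $\Gamma=\{x_1,\dots,x_n\}\subset\mathbb R^d$ be a grid whose affine hull is $\mathbb R^d$ and with $\operatorname{conv}(\Gamma)\supset\operatorname{supp}(\mathbb P_X)$. Let $\mathcal J^*_\Gamma$ be the dual quantization operator on $\Gamma$ and $\mathbb J^*_\Gamma$ its companion interpolation operator. Then for every function $F:\mathbb R^d\to\mathbb R$ that is differentiable in a neighbourhood of $\operatorname{conv}(\Gamma)$ with Lipschitz continuous partial derivatives on $\operatorname{conv}(\Gamma)$, the cubature formula $\mathbb E\,F(\mathcal J^*_\Gamma(X))=\sum_{i=1}^n p_i F(x_i)$, $p_i=\mathbb P_0\otimes\mathbb P(\mathcal J^*_\Gamma(X)=x_i)$, satisfies $$\bigl|\mathbb E\,F(X)-\mathbb E\,\mathbb J^*_\Gamma(F)(X)\bigr|=\bigl|\mathbb E\,F(X)-\mathbb E\,F(\mathcal J^*_\Gamma(X))\bigr|\le[F']_{\mathrm{Lip}}\;\mathbb E\,\|X-\mathcal J^*_\Gamma(X)\|^2 .$$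
   Context: $\mathbb R^d$ carries a fixed norm $\|\cdot\|$ and $p\in[1,\infty)$ is fixed. $[F']_{\mathrm{Lip}}$ is the Lipschitz constant of the differential $F'$ on $\operatorname{conv}(\Gamma)$ (with respect to $\|\cdot\|$ and its dual norm). For $\xi\in\operatorname{conv}(\Gamma)$ let $F^p(\xi;\Gamma)=\min\{\sum_{i=1}^n\lambda_i\|\xi-x_i\|^p:\lambda_i\ge0,\ \sum_i\lambda_ix_i=\xi,\ \sum_i\lambda_i=1\}$. Let $A$ be the $(d+1)\times n$ matrix with columns $\binom{x_i}{1}$, and for $I\subset\{1,\dots,n\}$ let $A_I$ be the submatrix of columns indexed by $I$. Let $\mathcal I(\Gamma)=\{I\subset\{1,\dots,n\}:|I|=d+1,\ \operatorname{rk}A_I=d+1\}$. For $I\in\mathcal I(\Gamma)$ and $\xi\in\mathbb R^d$ let $\lambda^I(\xi)\in\mathbb R^n$ have components on $I$ given by $A_I^{-1}\binom{\xi}{1}$ and components $0$ off $I$, and let $D_I(\Gamma)=\{\xi\in\mathbb R^d:\lambda^I(\xi)\ge0,\ \sum_{j\in I}\lambda^I_j(\xi)\|\xi-x_j\|^p=F^p(\xi;\Gamma)\}$. The sets $D_I(\Gamma)$ cover $\operatorname{conv}(\Gamma)$; fix a Borel partition $(C_I(\Gamma))_{I\in\mathcal I(\Gamma)}$ of $\operatorname{conv}(\Gamma)$ with $C_I(\Gamma)\subset D_I(\Gamma)$. Let $(\Omega_0,\mathcal S_0,\mathbb P_0)=([0,1],\mathcal B([0,1]),\lambda^1)$ and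 $U=\mathrm{Id}_{[0,1]}$. The dual quantization operator $\mathcal J^*_\Gamma:\Omega_0\times\operatorname{conv}(\Gamma)\to\Gamma$ is $$\mathcal J^*_\Gamma(\omega_0,\xi)=\sum_{I\in\mathcal I(\Gamma)}\Bigl[\sum_{i=1}^n x_i\,\mathbf 1_{\{\sum_{j=1}^{i-1}\lambda^I_j(\xi)\le U<\sum_{j=1}^{i}\lambda^I_j(\xi)\}}(\omega_0)\Bigr]\mathbf 1_{C_I(\Gamma)}(\xi),$$ and the companion interpolation operator maps $F:\operatorname{conv}(\Gamma)\to\mathbb R$ to $\mathbb J^*_\Gamma(F)(\xi)=\mathbb E_{\mathbb P_0}F(\mathcal J^*_\Gamma(\cdot,\xi))=\sum_{I}\bigl[\sum_{i\in I}\lambda^I_i(\xi)F(x_i)\bigr]\mathbf 1_{C_I(\Gamma)}(\xi)$. On the product space $(\Omega_0\times\Omega,\mathcal S_0\otimes\mathcal S,\mathbb P_0\otimes\mathbb P)$, $\mathcal J^*_\Gamma(X)$ denotes $(\omega_0,\omega)\mapsto\mathcal J^*_\Gamma(\omega_0,X(\omega))$ (defined almost surely), and $\mathbb E$ is expectation on this product space. *)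

theory Defs
  imports "HOL-Probability.Probability"
begin

definition is_norm :: "(real^'d \<Rightarrow> real) \<Rightarrow> bool" where
  "is_norm N \<longleftrightarrow>
     (\<forall>v. N v = 0 \<longleftrightarrow> v = 0) \<and>
     (\<forall>c v. N (c *\<^sub>R v) = \<bar>c\<bar> * N v) \<and>
     (\<forall>v w. N (v + w) \<le> N v + N w)"

definition dual_norm :: "(real^'d \<Rightarrow> real) \<Rightarrow> (real^'d \<Rightarrow> real) \<Rightarrow> real" where
  "dual_norm N l = Sup {\<bar>l v\<bar> | v. N v \<le> 1}"

definition differential_Lip ::
    "(real^'d \<Rightarrow> real) \<Rightarrow> (real^'d) set \<Rightarrow> (real^'d \<Rightarrow> real) \<Rightarrow> real" where
  "differential_Lip N S F =
     Sup {dual_norm N (\<lambda>v. frechet_derivative F (at \<xi>) v - frechet_derivative F (at \<eta>) v)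
            / N (\<xi> - \<eta>) | \<xi> \<eta>. \<xi> \<in> S \<and> \<eta> \<in> S \<and> \<xi> \<noteq> \<eta>}"

definition partial_derivative :: "(real^'d \<Rightarrow> real) \<Rightarrow> 'd \<Rightarrow> real^'d \<Rightarrow> real" where
  "partial_derivative F k \<xi> = deriv (\<lambda>t. F (\<xi> + t *\<^sub>R axis k 1)) 0"

definition measure_support :: "'a::topological_space measure \<Rightarrow> 'a set" where
  "measure_support \<mu> = {z. \<forall>V. open V \<and> z \<in> V \<longrightarrow> emeasure \<mu> V > 0}"

text \<open>
  A grid with \<open>n\<close> points is given by \<open>x :: nat \<Rightarrow> real^'d\<close>, of which only
  \<open>x 1, \<dots>, x n\<close> are relevant.
\<close>

text \<open>The minimum is attained, since the feasible weights form a nonempty compact set for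
  \<open>\<xi>\<close> in the convex hull; hence \<open>Inf\<close> is a minimum there.\<close>

definition dual_error ::
    "(real^'d \<Rightarrow> real) \<Rightarrow> real \<Rightarrow> (nat \<Rightarrow> real^'d) \<Rightarrow> nat \<Rightarrow> real^'d \<Rightarrow> real" where
  "dual_error N p x n \<xi> =
     Inf {(\<Sum>i=1..n. l i * N (\<xi> - x i) powr p) | l :: nat \<Rightarrow> real.
            (\<forall>i\<in>{1..n}. 0 \<le> l i) \<and> (\<Sum>i=1..n. l i *\<^sub>R x i) = \<xi> \<and> (\<Sum>i=1..n. l i) = 1}"

text \<open>
  The coordinate set \<open>'d option\<close> has \<open>d + 1\<close> elements; \<open>None\<close> is the additional coordinate.
  The columns of the square matrix \<open>A\<^sub>I\<close> are labelled by \<open>'d option\<close> as well, through a fixed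
  bijection onto \<open>I\<close>. Neither its rank nor the weights below depend on the choice of this
  labelling.
\<close>

definition lift_point :: "real^'d \<Rightarrow> real^('d option)" where
  "lift_point \<xi> = (\<chi> r. case r of None \<Rightarrow> 1 | Some k \<Rightarrow> \<xi> $ k)"

definition column_label :: "nat set \<Rightarrow> 'd option \<Rightarrow> nat" where
  "column_label I = (SOME e. bij_betw e UNIV I)"

definition submatrix_on :: "(nat \<Rightarrow> real^'d) \<Rightarrow> nat set \<Rightarrow> real^('d option)^('d option)" where
  "submatrix_on x I = (\<chi> r c. lift_point (x (column_label I c)) $ r)"

definition affine_bases :: "(nat \<Rightarrow> real^'d) \<Rightarrow> nat \<Rightarrow> nat set set" where
  "affine_bases x n =
     {I. I \<subseteq> {1..n} \<and> card I = CARD('d) + 1 \<and> rank (submatrix_on x I) = CARD('d) + 1}"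

definition bary_weight :: "(nat \<Rightarrow> real^'d) \<Rightarrow> nat set \<Rightarrow> real^'d \<Rightarrow> nat \<Rightarrow> real" where
  "bary_weight x I \<xi> j =
     (if j \<in> I
      then (matrix_inv (submatrix_on x I) *v lift_point \<xi>) $ (inv_into UNIV (column_label I) j)
      else 0)"

definition optimal_region ::
    "(real^'d \<Rightarrow> real) \<Rightarrow> real \<Rightarrow> (nat \<Rightarrow> real^'d) \<Rightarrow> nat \<Rightarrow> nat set \<Rightarrow> (real^'d) set" where
  "optimal_region N p x n I =
     {\<xi>. (\<forall>j\<in>{1..n}. 0 \<le> bary_weight x I \<xi> j) \<and>
         (\<Sum>j\<in>I. bary_weight x I \<xi> j * N (\<xi> - x j) powr p) = dual_error N p x n \<xi>}"

definition is_dual_partition ::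
    "(real^'d \<Rightarrow> real) \<Rightarrow> real \<Rightarrow> (nat \<Rightarrow> real^'d) \<Rightarrow> nat \<Rightarrow> (nat set \<Rightarrow> (real^'d) set) \<Rightarrow> bool"
  where
  "is_dual_partition N p x n C \<longleftrightarrow>
     (\<forall>I\<in>affine_bases x n. C I \<in> sets borel \<and> C I \<subseteq> optimal_region N p x n I) \<and>
     disjoint_family_on C (affine_bases x n) \<and>
     (\<Union>I\<in>affine_bases x n. C I) = convex hull (x ` {1..n})"

text \<open>
  The value is a grid point for \<open>\<omega>\<^sub>0 < 1\<close> and \<open>\<xi>\<close> in the convex hull. For \<open>\<omega>\<^sub>0 = 1\<close>, or for
  \<open>\<xi>\<close> outside the convex hull, the defining sum is empty and the value is \<open>0\<close>; these cases
  have probability \<open>0\<close>.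
\<close>

definition dual_quantizer ::
    "(nat \<Rightarrow> real^'d) \<Rightarrow> nat \<Rightarrow> (nat set \<Rightarrow> (real^'d) set) \<Rightarrow> real \<Rightarrow> real^'d \<Rightarrow> real^'d" where
  "dual_quantizer x n C \<omega>\<^sub>0 \<xi> =
     (\<Sum>I\<in>affine_bases x n.
        indicator (C I) \<xi> *\<^sub>R
        (\<Sum>i=1..n.
           indicator {u. (\<Sum>j=1..i-1. bary_weight x I \<xi> j) \<le> u \<and>
                         u < (\<Sum>j=1..i. bary_weight x I \<xi> j)} \<omega>\<^sub>0 *\<^sub>R x i))"

definition unit_space :: "real measure" where
  "unit_space = restrict_space lborel {0..1}"

definition companion_interpolation ::
    "(nat \<Rightarrow> real^'d) \<Rightarrow> nat \<Rightarrow> (nat set \<Rightarrow> (real^'d) set) \<Rightarrow> (real^'d \<Rightarrow> real) \<Rightarrow> real^'d \<Rightarrow> real"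
  where
  "companion_interpolation x n C F \<xi> = (\<integral>\<omega>\<^sub>0. F (dual_quantizer x n C \<omega>\<^sub>0 \<xi>) \<partial>unit_space)"

definition product_space :: "'w measure \<Rightarrow> (real \<times> 'w) measure" where
  "product_space M = unit_space \<Otimes>\<^sub>M M"

text \<open>
  Expectation of an almost surely defined random variable on the product space. The completion
  matters only for \<open>F (X \<omega>)\<close>: nothing is assumed about \<open>F\<close> far from the convex hull, where \<open>X\<close>
  may still take values on a null set, so that this function need only be measurable after
  changing it on a null set. For measurable functions the completion does not affect the integral.
\<close>

definition product_expectation :: "'w measure \<Rightarrow> (real \<times> 'w \<Rightarrow> real) \<Rightarrow> real" where
  "product_expectation M Y = integral\<^sup>L (completion (product_space M)) Y"

definition dual_quantization ::
    "(nat \<Rightarrow> real^'d) \<Rightarrow> nat \<Rightarrow> (nat set \<Rightarrow> (real^'d) set) \<Rightarrow> ('w \<Rightarrow> real^'d) \<Rightarrow> real \<times> 'w \<Rightarrow> real^'d"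
  where
  "dual_quantization x n C X = (\<lambda>(\<omega>\<^sub>0, \<omega>). dual_quantizer x n C \<omega>\<^sub>0 (X \<omega>))"

end

theory Submission
  imports Defs
begin

text \<open>
  On the convex hull, the quantizer takes the value \<open>x i\<close> for \<open>\<omega>\<^sub>0\<close> in a half-open interval whose
  length is the barycentric weight \<open>w \<xi> i\<close> of the cell containing \<open>\<xi>\<close>. By Fubini, each expectation
  becomes \<open>\<Sum>i. E (w X i * \<Phi> X (x i))\<close>. As the weights have barycentre \<open>\<xi>\<close>, the linear Taylor term
  \<open>F' \<xi> (x i - \<xi>)\<close> averages to zero, and the mean value theorem bounds the remainder by the Lipschitz
  constant of \<open>F'\<close> times \<open>(N (\<xi> - x i))\<^sup>2\<close>. The Lipschitz bound on the partial derivatives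
  ensures that the suprema in \<open>differential_Lip\<close> are over bounded sets.
\<close>

section \<open>Norms on \<open>real^'d\<close> and their comparison with the Euclidean norm\<close>

lemma is_norm_zero_iff: "is_norm N \<Longrightarrow> N v = 0 \<longleftrightarrow> v = 0"
  and is_norm_scale: "is_norm N \<Longrightarrow> N (c *\<^sub>R v) = \<bar>c\<bar> * N v"
  and is_norm_triangle: "is_norm N \<Longrightarrow> N (v + w) \<le> N v + N w"
  by (simp_all add: is_norm_def)

lemma is_norm_minus: "is_norm N \<Longrightarrow> N (- v) = N v"
  using is_norm_scale[of N "-1" v] by simp

lemma is_norm_nonneg:
  assumes "is_norm N"
  shows "0 \<le> N v"
  using is_norm_triangle[OF assms, of v "- v"] is_norm_zero_iff[OF assms, of 0]
    is_norm_minus[OF assms, of v] by simp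

lemma is_norm_sum:
  assumes "is_norm N"
  shows "N (\<Sum>i\<in>A. f i) \<le> (\<Sum>i\<in>A. N (f i))"
proof (induction A rule: infinite_finite_induct)
  case (insert i A)
  then show ?case
    using is_norm_triangle[OF assms, of "f i" "sum f A"] by simp
qed (use is_norm_zero_iff[OF assms, of 0] in auto)

text \<open>Expansion in the standard basis and the triangle inequality; each coordinate is at most
  the Euclidean norm.\<close>

lemma is_norm_le_norm:
  fixes N :: "real^'d \<Rightarrow> real"
  assumes "is_norm N"
  shows "N v \<le> (\<Sum>k\<in>UNIV. N (axis k 1)) * norm v"
proof -
  have "N v = N (\<Sum>k\<in>UNIV. v $ k *\<^sub>R axis k 1)"
    using basis_expansion[of v] by (simp add: scalar_mult_eq_scaleR)
  also have "\<dots> \<le> (\<Sum>k\<in>UNIV. \<bar>v $ k\<bar> * N (axis k 1))"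
    using is_norm_sum[OF assms, of "\<lambda>k. v $ k *\<^sub>R axis k 1" UNIV]
    by (simp add: is_norm_scale[OF assms])
  also have "\<dots> \<le> (\<Sum>k\<in>UNIV. norm v * N (axis k 1))"
    by (intro sum_mono mult_right_mono component_le_norm_cart is_norm_nonneg[OF assms])
  finally show ?thesis
    by (simp add: sum_distrib_left mult.commute)
qed

lemma continuous_on_is_norm:
  fixes N :: "real^'d \<Rightarrow> real"
  assumes "is_norm N"
  shows "continuous_on S N"
proof -
  define B where "B = (\<Sum>k\<in>UNIV. N (axis k 1 :: real^'d))"
  have B: "0 \<le> B"
    unfolding B_def by (intro sum_nonneg is_norm_nonneg[OF assms])
  have "dist (N v) (N w) \<le> B * dist v w" for v w
    using is_norm_triangle[OF assms, of "v - w" w] is_norm_triangle[OF assms, of "w - v" v]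
      is_norm_le_norm[OF assms, of "v - w"] is_norm_le_norm[OF assms, of "w - v"]
    unfolding B_def by (simp add: dist_real_def dist_norm norm_minus_commute abs_if)
  then have "B-lipschitz_on S N"
    by (intro lipschitz_onI B) auto
  then show ?thesis
    by (rule lipschitz_on_continuous_on)
qed

text \<open>By compactness the continuous function \<open>N\<close> attains a minimum on the
  Euclidean unit sphere. It is positive by definiteness, and homogeneity carries the bound to all
  vectors; \<open>c\<close> is its inverse.\<close>

lemma norm_le_is_norm:
  fixes N :: "real^'d \<Rightarrow> real"
  assumes "is_norm N"
  obtains c where "0 < c" "\<And>v. norm v \<le> c * N v"
proof -
  let ?S = "sphere (0 :: real^'d) 1"
  obtain u where u: "u \<in> ?S" "\<forall>v\<in>?S. N u \<le> N v"
    using continuous_attains_inf[OF compact_sphere _ continuous_on_is_norm[OF assms], of 0 1]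
    by auto
  have "N u \<noteq> 0"
    using is_norm_zero_iff[OF assms, of u] u(1) by auto
  then have pos: "0 < N u"
    using is_norm_nonneg[OF assms, of u] by simp
  have "norm v \<le> inverse (N u) * N v" for v
  proof (cases "v = 0")
    case False
    have "N u \<le> N (inverse (norm v) *\<^sub>R v)"
      using False by (intro u(2)[rule_format]) simp
    then show ?thesis
      using False pos by (simp add: is_norm_scale[OF assms] field_simps)
  qed (simp add: pos is_norm_nonneg[OF assms] less_imp_le)
  with pos show thesis
    by (intro that[of "inverse (N u)"]) auto
qed

text \<open>\<open>dual_norm\<close> is a real \<open>Sup\<close>, so it bounds its elements only
  once the set is known to be bounded. Comparison with the Euclidean norm provides this; then
  \<open>l\<close> is evaluated at \<open>v\<close> scaled to \<open>N\<close>-length one.\<close>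

lemma linear_le_dual_norm:
  fixes N :: "real^'d \<Rightarrow> real"
  assumes N: "is_norm N" and l: "linear l"
  shows "\<bar>l v\<bar> \<le> dual_norm N l * N v"
proof (cases "v = 0")
  case False
  then have pos: "0 < N v"
    using is_norm_nonneg[OF N, of v] is_norm_zero_iff[OF N, of v] by simp
  obtain c where c: "0 < c" "\<And>v. norm v \<le> c * N v"
    using norm_le_is_norm[OF N] by blast
  obtain b where b: "\<And>v. \<bar>l v\<bar> \<le> norm v * b" "0 \<le> b"
    using bounded_linear.nonneg_bounded[OF linear_conv_bounded_linear[THEN iffD1, OF l]] by auto
  have "\<bar>l w\<bar> \<le> c * b" if "N w \<le> 1" for w
  proof -
    have "norm w \<le> c"
      using c(2)[of w] mult_left_mono[OF that less_imp_le[OF c(1)]] by simp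
    then show ?thesis
      using b(1)[of w] b(2) mult_right_mono[of "norm w" c b] by simp
  qed
  then have "bdd_above {\<bar>l v\<bar> | v. N v \<le> 1}"
    by (intro bdd_aboveI[of _ "c * b"]) auto
  moreover have "N (inverse (N v) *\<^sub>R v) \<le> 1"
    using pos by (simp add: is_norm_scale[OF N])
  ultimately have "\<bar>l (inverse (N v) *\<^sub>R v)\<bar> \<le> dual_norm N l"
    unfolding dual_norm_def by (intro cSup_upper) auto
  then show ?thesis
    using pos by (simp add: linear_cmul[OF l] abs_mult field_simps)
qed (use linear_0[OF l] is_norm_zero_iff[OF N, of 0] in simp)

section \<open>The differential and its Lipschitz constant\<close>

lemma partial_derivative_eq:
  assumes "(F has_derivative F') (at \<xi>)"
  shows "partial_derivative F k \<xi> = F' (axis k 1)"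
proof -
  have "((\<lambda>t. F (\<xi> + t *\<^sub>R axis k 1)) has_derivative (\<lambda>t. F' (t *\<^sub>R axis k 1))) (at 0)"
    using assms by (intro has_derivative_compose[of "\<lambda>t. \<xi> + t *\<^sub>R axis k 1" _ 0 _ F F'])
      (auto intro!: derivative_eq_intros)
  then have "((\<lambda>t. F (\<xi> + t *\<^sub>R axis k 1)) has_field_derivative F' (axis k 1)) (at 0)"
    unfolding has_field_derivative_def
    by (rule has_derivative_eq_rhs)
      (simp add: fun_eq_iff linear_cmul[OF has_derivative_linear[OF assms]])
  then show ?thesis
    unfolding partial_derivative_def by (rule DERIV_imp_deriv)
qed

text \<open>The difference quotients of the differential have to be bounded before
  \<open>differential_Lip\<close> can serve as an upper bound for them. The Lipschitz constants of
  the partial derivatives give such a bound, since the coordinates of the differential are the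
  partial derivatives.\<close>

lemma derivative_diff_le_differential_Lip:
  fixes F :: "real^'d \<Rightarrow> real"
  assumes N: "is_norm N"
    and diff: "\<And>\<xi>. \<xi> \<in> S \<Longrightarrow> F differentiable at \<xi>"
    and lip: "\<And>k. \<exists>L. L-lipschitz_on S (partial_derivative F k)"
    and S: "\<xi> \<in> S" "\<eta> \<in> S"
  shows "\<bar>frechet_derivative F (at \<xi>) v - frechet_derivative F (at \<eta>) v\<bar>
           \<le> differential_Lip N S F * N (\<xi> - \<eta>) * N v"
proof (cases "\<xi> = \<eta>")
  case False
  define l where "l \<xi> \<eta> v = frechet_derivative F (at \<xi>) v - frechet_derivative F (at \<eta>) v" for \<xi> \<eta> v
  have lin: "linear (l \<xi> \<eta>)" if "\<xi> \<in> S" "\<eta> \<in> S" for \<xi> \<eta>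
    unfolding l_def using that diff by (intro linear_compose_sub linear_frechet_derivative) auto
  have pos: "0 < N (\<xi> - \<eta>)" if "\<xi> \<noteq> \<eta>" for \<xi> \<eta>
    using is_norm_nonneg[OF N, of "\<xi> - \<eta>"] is_norm_zero_iff[OF N, of "\<xi> - \<eta>"] that by simp
  obtain c where c: "0 < c" "\<And>v. norm v \<le> c * N v"
    using norm_le_is_norm[OF N] by blast
  obtain L where L: "\<And>k. (L k)-lipschitz_on S (partial_derivative F k)"
    using lip by metis
  have L0: "0 \<le> L k" for k :: 'd
    using lipschitz_on_nonneg[OF L] .
  \<comment> \<open>One factor \<open>c\<close> bounds the coordinates of a vector in the
    \<open>N\<close>-unit ball, the other converts the Euclidean distance of the two base points
    into their \<open>N\<close>-distance.\<close>
  define B where "B = (\<Sum>k\<in>UNIV. c * L k * c)"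
  have le: "\<bar>l \<xi> \<eta> v\<bar> \<le> B * N (\<xi> - \<eta>)" if h: "\<xi> \<in> S" "\<eta> \<in> S" "N v \<le> 1" for \<xi> \<eta> v
  proof -
    have "l \<xi> \<eta> v = l \<xi> \<eta> (\<Sum>k\<in>UNIV. v $ k *\<^sub>R axis k 1)"
      using basis_expansion[of v] by (simp add: scalar_mult_eq_scaleR)
    also have "\<dots> = (\<Sum>k\<in>UNIV. v $ k * l \<xi> \<eta> (axis k 1))"
      using lin[OF h(1,2)] by (simp add: linear_sum linear_cmul)
    also have "\<dots> = (\<Sum>k\<in>UNIV. v $ k * (partial_derivative F k \<xi> - partial_derivative F k \<eta>))"
      using partial_derivative_eq[OF diff[OF h(1), unfolded frechet_derivative_works]]
        partial_derivative_eq[OF diff[OF h(2), unfolded frechet_derivative_works]]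
      by (simp add: l_def)
    finally have "\<bar>l \<xi> \<eta> v\<bar> \<le> (\<Sum>k\<in>UNIV. \<bar>v $ k\<bar> * \<bar>partial_derivative F k \<xi> - partial_derivative F k \<eta>\<bar>)"
      using sum_abs[of "\<lambda>k. v $ k * (partial_derivative F k \<xi> - partial_derivative F k \<eta>)" UNIV]
      by (simp add: abs_mult)
    also have "\<dots> \<le> (\<Sum>k\<in>UNIV. c * (L k * (c * N (\<xi> - \<eta>))))"
    proof (intro sum_mono mult_mono)
      fix k
      have "norm v \<le> c"
        using c(2)[of v] mult_left_mono[OF h(3) less_imp_le[OF c(1)]] by simp
      then show "\<bar>v $ k\<bar> \<le> c"
        using component_le_norm_cart[of v k] by simp
      have "\<bar>partial_derivative F k \<xi> - partial_derivative F k \<eta>\<bar> \<le> L k * norm (\<xi> - \<eta>)"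
        using lipschitz_onD[OF L h(1,2), of k] by (simp add: dist_norm)
      also have "\<dots> \<le> L k * (c * N (\<xi> - \<eta>))"
        by (intro mult_left_mono c L0)
      finally show "\<bar>partial_derivative F k \<xi> - partial_derivative F k \<eta>\<bar> \<le> L k * (c * N (\<xi> - \<eta>))" .
    qed (use c in auto)
    finally show ?thesis
      by (simp add: B_def sum_distrib_right mult.assoc)
  qed
  have "dual_norm N (l \<xi> \<eta>) / N (\<xi> - \<eta>) \<le> B" if h: "\<xi> \<in> S" "\<eta> \<in> S" "\<xi> \<noteq> \<eta>" for \<xi> \<eta>
  proof -
    \<comment> \<open>The zero vector makes the set in \<open>dual_norm\<close> nonempty, as
      \<open>cSup_least\<close> requires.\<close>
    have "N 0 \<le> 1"
      using is_norm_zero_iff[OF N, of 0] by simp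
    then have "dual_norm N (l \<xi> \<eta>) \<le> B * N (\<xi> - \<eta>)"
      unfolding dual_norm_def using le[OF h(1,2)] by (intro cSup_least) auto
    then show ?thesis
      using pos[OF h(3)] by (simp add: field_simps)
  qed
  then have "dual_norm N (l \<xi> \<eta>) / N (\<xi> - \<eta>) \<le> differential_Lip N S F"
    unfolding differential_Lip_def l_def using S False
    by (intro cSup_upper bdd_aboveI[of _ B]) auto
  then have "dual_norm N (l \<xi> \<eta>) \<le> differential_Lip N S F * N (\<xi> - \<eta>)"
    using pos[OF False] by (simp add: field_simps)
  then have "dual_norm N (l \<xi> \<eta>) * N v \<le> differential_Lip N S F * N (\<xi> - \<eta>) * N v"
    by (intro mult_right_mono is_norm_nonneg[OF N])
  with linear_le_dual_norm[OF N lin[OF S], of v] show ?thesis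
    by (simp add: l_def)
qed (use is_norm_zero_iff[OF N, of 0] in simp)

text \<open>The mean value theorem on the segment from \<open>\<xi>\<close> to \<open>y\<close>
  replaces the increment of \<open>F\<close> by the differential at an intermediate point
  \<open>z t\<close>, whose distance from \<open>\<xi>\<close> is \<open>t\<close> times the full
  distance. Bounding \<open>t\<close> by 1 gives the constant without a factor 1/2.\<close>

lemma taylor_differential_Lip:
  fixes F :: "real^'d \<Rightarrow> real"
  assumes N: "is_norm N" and "convex S"
    and diff: "\<And>\<xi>. \<xi> \<in> S \<Longrightarrow> F differentiable at \<xi>"
    and lip: "\<And>k. \<exists>L. L-lipschitz_on S (partial_derivative F k)"
    and S: "\<xi> \<in> S" "y \<in> S"
  shows "\<bar>F y - F \<xi> - frechet_derivative F (at \<xi>) (y - \<xi>)\<bar>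
           \<le> differential_Lip N S F * (N (\<xi> - y))\<^sup>2"
proof (cases "\<xi> = y")
  case False
  define z where "z t = \<xi> + t *\<^sub>R (y - \<xi>)" for t :: real
  have z: "z t \<in> S" if "t \<in> {0..1}" for t
    using convexD_alt[OF \<open>convex S\<close> S, of t] that by (simp add: z_def algebra_simps)
  have "((\<lambda>t. F (z t)) has_derivative (\<lambda>s. frechet_derivative F (at (z t)) (s *\<^sub>R (y - \<xi>))))
          (at t within {0..1})" if "t \<in> {0..1}" for t
  proof (rule has_derivative_compose[of z])
    show "(z has_derivative (\<lambda>s. s *\<^sub>R (y - \<xi>))) (at t within {0..1})"
      unfolding z_def by (auto intro!: derivative_eq_intros)
    show "(F has_derivative frechet_derivative F (at (z t))) (at (z t))"
      using diff[OF z[OF that]] frechet_derivative_works by blast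
  qed
  from mvt_simple[OF zero_less_one this] obtain t where t: "t \<in> {0<..<1}"
      "F (z 1) - F (z 0) = frechet_derivative F (at (z t)) ((1 - 0) *\<^sub>R (y - \<xi>))"
    by auto
  let ?L = "differential_Lip N S F"
  have Nyx: "N (y - \<xi>) = N (\<xi> - y)"
    using is_norm_minus[OF N, of "y - \<xi>"] by simp
  have pos: "0 < N (\<xi> - y)"
    using is_norm_nonneg[OF N, of "\<xi> - y"] is_norm_zero_iff[OF N, of "\<xi> - y"] False by simp
  have le: "\<bar>frechet_derivative F (at (z t)) (y - \<xi>) - frechet_derivative F (at \<xi>) (y - \<xi>)\<bar>
      \<le> ?L * N (z t - \<xi>) * N (y - \<xi>)"
    using t(1) S by (intro derivative_diff_le_differential_Lip N diff lip z) auto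
  also have "\<dots> = t * (?L * (N (\<xi> - y))\<^sup>2)"
    using t(1) by (simp add: z_def is_norm_scale[OF N] Nyx power2_eq_square)
  finally have *: "\<bar>frechet_derivative F (at (z t)) (y - \<xi>) - frechet_derivative F (at \<xi>) (y - \<xi>)\<bar>
      \<le> t * (?L * (N (\<xi> - y))\<^sup>2)" .
  \<comment> \<open>The sign of the Lipschitz constant, needed to drop the factor \<open>t\<close>,
    is read off from the fact that the right-hand side dominates an absolute value.\<close>
  then have "0 \<le> t * (?L * (N (\<xi> - y))\<^sup>2)"
    by linarith
  then have "0 \<le> ?L * (N (\<xi> - y))\<^sup>2"
    using t(1) by (simp add: zero_le_mult_iff)
  then have "t * (?L * (N (\<xi> - y))\<^sup>2) \<le> ?L * (N (\<xi> - y))\<^sup>2"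
    using t(1) by (intro mult_left_le_one_le) auto
  with * t(2) show ?thesis
    by (simp add: z_def)
next
  case True
  then show ?thesis
    using is_norm_zero_iff[OF N, of 0] linear_0[OF linear_frechet_derivative[OF diff[OF S(2)]]]
    by simp
qed

section \<open>The support of a Borel measure\<close>

text \<open>The complement of the support is the union of all open null sets. By the Lindelof
  property countably many of them already have the same union, which is therefore null.\<close>

lemma AE_measure_support:
  fixes \<mu> :: "'a::second_countable_topology measure"
  assumes "sets \<mu> = sets borel"
  shows "AE z in \<mu>. z \<in> measure_support \<mu>"
proof -
  let ?\<U> = "{V. open V \<and> emeasure \<mu> V = 0}"
  obtain \<V> where \<V>: "\<V> \<subseteq> ?\<U>" "countable \<V>" "\<Union>\<V> = \<Union>?\<U>"
    using Lindelof[of ?\<U>] by auto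
  have "V \<in> null_sets \<mu>" if "V \<in> \<V>" for V
    using \<V>(1) that assms by (intro null_setsI) (auto intro: borel_open)
  then have "\<Union>\<V> \<in> null_sets \<mu>"
    using null_sets_UN'[OF \<V>(2), of "\<lambda>V. V"] by simp
  moreover have "{z \<in> space \<mu>. z \<notin> measure_support \<mu>} \<subseteq> \<Union>\<V>"
    unfolding \<V>(3) measure_support_def by (auto simp: not_gr_zero)
  ultimately show ?thesis
    by (rule AE_I')
qed

section \<open>Barycentric weights\<close>

text \<open>Both identities are rows of the linear system solved by the weights: the row
  \<open>None\<close> of ones gives the total mass, the rows \<open>Some k\<close> give the
  barycentre.\<close>

lemma bary_weight_sums:
  fixes x :: "nat \<Rightarrow> real^'d"
  assumes I: "I \<in> affine_bases x n"
  shows "(\<Sum>i=1..n. bary_weight x I \<xi> i) = 1"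
    and "(\<Sum>i=1..n. bary_weight x I \<xi> i *\<^sub>R x i) = \<xi>"
proof -
  let ?e = "column_label I :: 'd option \<Rightarrow> nat" and ?A = "submatrix_on x I"
  have fin: "finite I" and sub: "I \<subseteq> {1..n}"
    using I finite_subset[of I "{1..n}"] by (auto simp: affine_bases_def)
  have "\<exists>e. bij_betw e (UNIV :: 'd option set) I"
    using I fin by (intro finite_same_card_bij) (auto simp: affine_bases_def)
  then have e: "bij_betw ?e UNIV I"
    unfolding column_label_def by (rule someI_ex)
  have "invertible ?A"
    using I by (simp add: affine_bases_def matrix_left_invertible_injective
        full_rank_injective[symmetric] invertible_left_inverse)
  then have "?A ** matrix_inv ?A = mat 1"
    unfolding invertible_def matrix_inv_def by (rule someI2_ex) simp
  then have "?A *v (matrix_inv ?A *v lift_point \<xi>) = lift_point \<xi>"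
    by (simp add: matrix_vector_mul_assoc)
  then have *: "(\<Sum>c\<in>UNIV. lift_point (x (?e c)) $ r * bary_weight x I \<xi> (?e c)) = lift_point \<xi> $ r" for r
    using e by (simp add: matrix_vector_mult_def submatrix_on_def bary_weight_def vec_eq_iff
        bij_betw_apply inv_into_f_f[OF bij_betw_imp_inj_on[OF e]])
  \<comment> \<open>Weights vanish off \<open>I\<close>, so the sum over the columns of the matrix
    is a sum over the whole grid.\<close>
  have **: "(\<Sum>i=1..n. lift_point (x i) $ r * bary_weight x I \<xi> i) = lift_point \<xi> $ r" for r
  proof -
    have "(\<Sum>i=1..n. lift_point (x i) $ r * bary_weight x I \<xi> i)
            = (\<Sum>i\<in>I. lift_point (x i) $ r * bary_weight x I \<xi> i)"
      using sub by (intro sum.mono_neutral_right) (auto simp: bary_weight_def)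
    then show ?thesis
      using *[of r] sum.reindex_bij_betw[OF e, of "\<lambda>i. lift_point (x i) $ r * bary_weight x I \<xi> i"]
      by simp
  qed
  show "(\<Sum>i=1..n. bary_weight x I \<xi> i) = 1"
    using **[of None] by (simp add: lift_point_def)
  show "(\<Sum>i=1..n. bary_weight x I \<xi> i *\<^sub>R x i) = \<xi>"
    unfolding vec_eq_iff using **[of "Some k" for k] by (simp add: lift_point_def mult.commute)
qed

text \<open>For fixed \<open>I\<close> the weight is an affine function of \<open>\<xi>\<close>,
  hence continuous.\<close>

lemma borel_measurable_bary_weight [measurable]:
  fixes x :: "nat \<Rightarrow> real^'d"
  shows "(\<lambda>\<xi>. bary_weight x I \<xi> i) \<in> borel_measurable borel"
proof -
  have "continuous_on UNIV (\<lambda>\<xi> :: real^'d. lift_point \<xi> $ r)" for r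
    by (cases r) (auto simp: lift_point_def intro!: continuous_intros)
  then have "continuous_on UNIV (\<lambda>\<xi>. bary_weight x I \<xi> i)"
    unfolding bary_weight_def matrix_vector_mult_def
    by (cases "i \<in> I") (simp_all del: continuous_on_component add: continuous_on_sum continuous_on_mult_left)
  then show ?thesis
    by (rule borel_measurable_continuous_onI)
qed

section \<open>Weights and slots of the quantizer\<close>

text \<open>Gluing by indicators makes the weights of the cell containing \<open>\<xi>\<close> a
  single function of \<open>\<xi>\<close>, whose measurability follows from that of the
  cells.\<close>

definition dual_weight ::
    "(nat \<Rightarrow> real^'d) \<Rightarrow> nat \<Rightarrow> (nat set \<Rightarrow> (real^'d) set) \<Rightarrow> real^'d \<Rightarrow> nat \<Rightarrow> real" where
  "dual_weight x n C \<xi> i =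
     (\<Sum>I\<in>affine_bases x n. indicator (C I) \<xi> * bary_weight x I \<xi> i)"

text \<open>For \<open>\<xi>\<close> in the hull and distinct grid points, this is the set of those
  \<open>\<omega>\<^sub>0\<close> in [0,1) for which the quantizer returns \<open>x i\<close>.
  Half-open intervals make the slots tile [0,1) without overlap; a zero weight gives an empty
  slot.\<close>

definition dual_slot ::
    "(nat \<Rightarrow> real^'d) \<Rightarrow> nat \<Rightarrow> (nat set \<Rightarrow> (real^'d) set) \<Rightarrow> real^'d \<Rightarrow> nat \<Rightarrow> real set" where
  "dual_slot x n C \<xi> i =
     {(\<Sum>j=1..i-1. dual_weight x n C \<xi> j)..<(\<Sum>j=1..i. dual_weight x n C \<xi> j)}"

lemma finite_affine_bases: "finite (affine_bases x n)"
  by (rule finite_subset[of _ "Pow {1..n}"]) (auto simp: affine_bases_def)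

text \<open>Disjointness leaves one nonzero indicator, so every sum over cells collapses to the term
  of the cell that contains \<open>\<xi>\<close>.\<close>

lemma dual_partition_cell:
  assumes "is_dual_partition N p x n C" and "\<xi> \<in> convex hull (x ` {1..n})"
  obtains I where "I \<in> affine_bases x n" "\<xi> \<in> optimal_region N p x n I"
    "\<And>f. (\<Sum>J\<in>affine_bases x n. indicator (C J) \<xi> * f J) = (f I :: real)"
proof -
  obtain I where I: "I \<in> affine_bases x n" "\<xi> \<in> C I"
    using assms unfolding is_dual_partition_def by blast
  have "\<xi> \<notin> C J" if "J \<in> affine_bases x n" "J \<noteq> I" for J
    using assms(1) I that unfolding is_dual_partition_def disjoint_family_on_def by blast
  then have "(\<Sum>J\<in>affine_bases x n. indicator (C J) \<xi> * f J)
               = (\<Sum>J\<in>affine_bases x n. if J = I then f I else 0)" for f :: "nat set \<Rightarrow> real"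
    using I(2) by (intro sum.cong) auto
  then show thesis
    using I assms(1) by (intro that[of I])
      (auto simp: is_dual_partition_def sum.delta[OF finite_affine_bases])
qed

lemma dual_weight_sums:
  fixes x :: "nat \<Rightarrow> real^'d"
  assumes "is_dual_partition N p x n C" and "\<xi> \<in> convex hull (x ` {1..n})"
  shows "\<And>i. i \<in> {1..n} \<Longrightarrow> 0 \<le> dual_weight x n C \<xi> i"
    and "(\<Sum>i=1..n. dual_weight x n C \<xi> i) = 1"
    and "(\<Sum>i=1..n. dual_weight x n C \<xi> i *\<^sub>R x i) = \<xi>"
    and "dual_quantizer x n C u \<xi> = (\<Sum>i=1..n. indicator (dual_slot x n C \<xi> i) u *\<^sub>R x i)"
proof -
  obtain I where I: "I \<in> affine_bases x n" "\<xi> \<in> optimal_region N p x n I"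
    and sum: "\<And>f. (\<Sum>J\<in>affine_bases x n. indicator (C J) \<xi> * f J) = (f I :: real)"
    by (rule dual_partition_cell[OF assms]) blast
  have w: "dual_weight x n C \<xi> i = bary_weight x I \<xi> i" for i
    using sum[of "\<lambda>J. bary_weight x J \<xi> i"] by (simp add: dual_weight_def)
  show "0 \<le> dual_weight x n C \<xi> i" if "i \<in> {1..n}" for i
    using I(2) that by (simp add: w optimal_region_def)
  show "(\<Sum>i=1..n. dual_weight x n C \<xi> i) = 1"
    and "(\<Sum>i=1..n. dual_weight x n C \<xi> i *\<^sub>R x i) = \<xi>"
    using bary_weight_sums[OF I(1)] by (simp_all add: w)
  \<comment> \<open>The collapse is available for real terms only, so it is applied to each
    coordinate.\<close>
  have "(\<Sum>J\<in>affine_bases x n. indicator (C J) \<xi> *\<^sub>R f J) = f I" for f :: "nat set \<Rightarrow> real^'d"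
    unfolding vec_eq_iff using sum[of "\<lambda>J. f J $ k" for k] by simp
  then show "dual_quantizer x n C u \<xi> = (\<Sum>i=1..n. indicator (dual_slot x n C \<xi> i) u *\<^sub>R x i)"
    unfolding dual_quantizer_def dual_slot_def w atLeastLessThan_def atLeast_def lessThan_def
    by (simp add: Int_def)
qed

text \<open>The partial sums increase weakly from 0 to a total above \<open>u\<close>, so the slot
  containing \<open>u\<close> is the one ending at the first partial sum that exceeds
  \<open>u\<close>.\<close>

lemma ex_partial_sum_slot:
  fixes w :: "nat \<Rightarrow> real"
  assumes nonneg: "\<And>i. i \<in> {1..n} \<Longrightarrow> 0 \<le> w i" and u: "0 \<le> u" "u < (\<Sum>i=1..n. w i)"
  obtains i where "i \<in> {1..n}"
    "\<And>j. j \<in> {1..n} \<Longrightarrow> u \<in> {(\<Sum>k=1..j-1. w k)..<(\<Sum>k=1..j. w k)} \<longleftrightarrow> j = i"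
proof -
  define S where "S i = (\<Sum>k=1..i. w k)" for i
  define i where "i = (LEAST i. u < S i)"
  have i: "u < S i" "i \<le> n" and least: "\<And>j. j < i \<Longrightarrow> S j \<le> u"
    using u(2) LeastI[of "\<lambda>i. u < S i" n] Least_le[of "\<lambda>i. u < S i" n] not_less_Least[of _ "\<lambda>i. u < S i"]
    by (auto simp: S_def i_def not_less)
  have mono: "S j \<le> S k" if "j \<le> k" "k \<le> n" for j k
    unfolding S_def using that nonneg by (intro sum_mono2) auto
  \<comment> \<open>The empty sum is 0 and \<open>u\<close> is nonnegative; this keeps the index
    inside the grid range.\<close>
  have "i \<noteq> 0"
    using i(1) u(1) by (auto simp: S_def intro: gr0I)
  have "u \<in> {S (j - 1)..<S j} \<longleftrightarrow> j = i" if j: "j \<in> {1..n}" for j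
  proof (cases i j rule: linorder_cases)
    case less
    then have "S i \<le> S (j - 1)"
      using j by (intro mono) auto
    then show ?thesis
      using i(1) less by simp
  next
    case equal
    then show ?thesis
      using i(1) least[of "j - 1"] j by simp
  next
    case greater
    then show ?thesis
      using least[of j] by simp
  qed
  then show thesis
    using i(2) \<open>i \<noteq> 0\<close> by (intro that[of i]) (auto simp: S_def)
qed

text \<open>Exactly one slot contains \<open>u\<close>, so even a nonlinear \<open>G\<close> passes
  through the sum. The value \<open>u = 1\<close> is excluded because no slot contains it.\<close>

lemma dual_quantizer_sum:
  fixes x :: "nat \<Rightarrow> real^'d" and G :: "real^'d \<Rightarrow> real"
  assumes "is_dual_partition N p x n C" and "\<xi> \<in> convex hull (x ` {1..n})" and "0 \<le> u" "u < 1"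
  shows "G (dual_quantizer x n C u \<xi>) = (\<Sum>i=1..n. indicator (dual_slot x n C \<xi> i) u * G (x i))"
proof -
  note w = dual_weight_sums[OF assms(1,2)]
  obtain i where i: "i \<in> {1..n}" and slot: "\<And>j. j \<in> {1..n} \<Longrightarrow> u \<in> dual_slot x n C \<xi> j \<longleftrightarrow> j = i"
    unfolding dual_slot_def using ex_partial_sum_slot[of n "dual_weight x n C \<xi>" u] w(1,2) assms(3,4)
    by metis
  have "(\<Sum>j=1..n. indicator (dual_slot x n C \<xi> j) u *\<^sub>R x j) = (\<Sum>j=1..n. if j = i then x i else 0)"
    by (intro sum.cong) (auto simp: slot indicator_def)
  moreover have "(\<Sum>j=1..n. indicator (dual_slot x n C \<xi> j) u * G (x j)) = (\<Sum>j=1..n. if j = i then G (x i) else 0)"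
    by (intro sum.cong) (auto simp: slot indicator_def)
  ultimately show ?thesis
    using i by (simp add: w(4))
qed

section \<open>Integration over the auxiliary unit interval\<close>

lemma prob_space_unit_space: "prob_space unit_space"
  unfolding unit_space_def by (rule prob_space_restrict_space) auto

lemma space_unit_space: "space unit_space = {0..1}"
  by (simp add: unit_space_def space_restrict_space)

lemma measurable_unit_space [measurable]: "(\<lambda>u. u) \<in> borel_measurable unit_space"
  unfolding unit_space_def by (rule measurable_restrict_space1) simp

lemma AE_unit_space: "AE u in unit_space. 0 \<le> u \<and> u < 1"
proof -
  have "AE u in lborel. u \<in> {0..1} \<longrightarrow> 0 \<le> u \<and> u < (1::real)"
    using AE_lborel_singleton[of "1::real"] by eventually_elim auto
  then show ?thesis
    unfolding unit_space_def by (subst AE_restrict_space_iff) auto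
qed

text \<open>Nonnegative weights of total mass one keep the slot inside the unit interval, so
  restricting Lebesgue measure does not change its length, which is a difference of consecutive
  partial sums.\<close>

lemma integral_dual_slot:
  fixes x :: "nat \<Rightarrow> real^'d"
  assumes "is_dual_partition N p x n C" and "\<xi> \<in> convex hull (x ` {1..n})" and i: "i \<in> {1..n}"
  shows "(\<integral>u. indicator (dual_slot x n C \<xi> i) u \<partial>unit_space) = dual_weight x n C \<xi> i"
proof -
  note w = dual_weight_sums[OF assms(1,2)]
  let ?S = "\<lambda>i. \<Sum>j=1..i. dual_weight x n C \<xi> j"
  have "0 \<le> ?S (i - 1)"
    using w(1) i by (intro sum_nonneg) auto
  moreover have "?S i \<le> ?S n"
    using w(1) i by (intro sum_mono2) auto
  moreover have S: "?S i = ?S (i - 1) + dual_weight x n C \<xi> i"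
    using i sum.cl_ivl_Suc[of _ 1 "i - 1"] by simp
  ultimately have "dual_slot x n C \<xi> i \<subseteq> {0..1}"
    unfolding dual_slot_def w(2) by (auto simp: subset_eq)
  then have "(\<integral>u. indicator (dual_slot x n C \<xi> i) u \<partial>unit_space) = measure lborel (dual_slot x n C \<xi> i)"
    unfolding unit_space_def
    by (simp add: space_restrict_space measure_restrict_space Int_absorb2 Int_absorb1)
  also have "\<dots> = dual_weight x n C \<xi> i"
    using S w(1)[OF i] by (simp add: dual_slot_def)
  finally show ?thesis .
qed

lemma integrable_dual_slot:
  "integrable unit_space (\<lambda>u. indicator (dual_slot x n C \<xi> i) u * c :: real)"
proof -
  interpret prob_space unit_space
    by (rule prob_space_unit_space)
  show ?thesis
    unfolding dual_slot_def
    by (rule integrable_const_bound[of _ "\<bar>c\<bar>"]) (auto simp: indicator_def)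
qed

lemma companion_interpolation_eq:
  fixes x :: "nat \<Rightarrow> real^'d"
  assumes "is_dual_partition N p x n C" and "\<xi> \<in> convex hull (x ` {1..n})"
  shows "companion_interpolation x n C F \<xi> = (\<Sum>i=1..n. dual_weight x n C \<xi> i * F (x i))"
proof -
  have "companion_interpolation x n C F \<xi>
          = (\<integral>u. (\<Sum>i=1..n. indicator (dual_slot x n C \<xi> i) u * F (x i)) \<partial>unit_space)"
    unfolding companion_interpolation_def
  \<comment> \<open>The two integrands can differ only at the null point 1. This rule asks for no
    measurability of \<open>F\<close> composed with the quantizer.\<close>
  proof (rule integral_discrete_difference[of "{1}"])
    show "F (dual_quantizer x n C u \<xi>) = (\<Sum>i=1..n. indicator (dual_slot x n C \<xi> i) u * F (x i))"
      if "u \<in> space unit_space" "u \<notin> {1}" for u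
      using that by (intro dual_quantizer_sum[OF assms]) (auto simp: space_unit_space)
  qed (auto simp: unit_space_def sets_restrict_space emeasure_restrict_space)
  also have "\<dots> = (\<Sum>i=1..n. dual_weight x n C \<xi> i * F (x i))"
    by (subst Bochner_Integration.integral_sum[OF integrable_dual_slot], intro sum.cong refl,
        subst integral_mult_left_zero, simp only: integral_dual_slot[OF assms])
  finally show ?thesis .
qed

section \<open>Measurability\<close>

lemma borel_measurable_dual_weight:
  assumes "is_dual_partition N p x n C"
  shows "(\<lambda>\<xi>. dual_weight x n C \<xi> i) \<in> borel_measurable borel"
  unfolding dual_weight_def
proof (intro borel_measurable_sum borel_measurable_times borel_measurable_bary_weight)
  show "indicator (C I) \<in> borel_measurable borel" if "I \<in> affine_bases x n" for I
    using assms that by (intro borel_measurable_indicator) (auto simp: is_dual_partition_def)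
qed

lemma borel_measurable_dual_quantization:
  assumes "is_dual_partition N p x n C" and [measurable]: "X \<in> borel_measurable M"
  shows "dual_quantization x n C X \<in> borel_measurable (product_space M)"
proof -
  have [measurable]: "(\<lambda>z. indicator (C I) (X (snd z)) :: real) \<in> borel_measurable (product_space M)"
    if "I \<in> affine_bases x n" for I
  proof -
    have [measurable]: "C I \<in> sets borel"
      using assms that by (auto simp: is_dual_partition_def)
    show ?thesis
      unfolding product_space_def by measurable
  qed
  have [measurable]: "(\<lambda>z. bary_weight x I (X (snd z)) j) \<in> borel_measurable (product_space M)" for I j
    using borel_measurable_bary_weight[of x I j] unfolding product_space_def by measurable
  have [measurable]: "fst \<in> borel_measurable (product_space M)"
    using measurable_compose[OF measurable_fst measurable_unit_space] unfolding product_space_def .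
  show ?thesis
    unfolding dual_quantization_def dual_quantizer_def case_prod_beta indicator_def [of "{u. _ u}"] mem_Collect_eq
    by (intro borel_measurable_sum borel_measurable_scaleR) measurable
qed

text \<open>In a complete measure space a set that agrees almost everywhere with a measurable set is
  measurable; this is applied to preimages.\<close>

lemma borel_measurable_completion_AE:
  assumes f: "f \<in> borel_measurable (completion M)" and ae: "AE z in completion M. g z = f z"
  shows "g \<in> borel_measurable (completion M)"
proof (rule measurableI)
  fix A :: "'b set"
  assume A: "A \<in> sets borel"
  have "AE z in completion M. z \<in> f -` A \<inter> space (completion M) \<longleftrightarrow> z \<in> g -` A \<inter> space (completion M)"
    using ae by eventually_elim simp
  then show "g -` A \<inter> space (completion M) \<in> sets (completion M)"
    by (rule completion.in_sets_AE) (use measurable_sets[OF f A] in auto)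
qed simp

section \<open>Expectations on the product space\<close>

locale dual_quantization_setup =
  fixes N :: "real^'d \<Rightarrow> real" and p :: real and x :: "nat \<Rightarrow> real^'d" and n :: nat
    and C :: "nat set \<Rightarrow> (real^'d) set" and M :: "'w measure" and X :: "'w \<Rightarrow> real^'d"
  assumes partition: "is_dual_partition N p x n C"
    and prob_M: "prob_space M"
    and X [measurable]: "X \<in> borel_measurable M"
    and X_in_hull: "AE \<omega> in M. X \<omega> \<in> convex hull (x ` {1..n})"
begin

abbreviation "K \<equiv> convex hull (x ` {1..n})"

abbreviation "w \<equiv> dual_weight x n C"

text \<open>Nothing is known about \<open>F\<close> far from the hull, so measurability is asked
  only after cutting off by the indicator of \<open>K\<close>. Boundedness on \<open>K\<close> then
  yields integrability.\<close>

abbreviation hull_bounded :: "(real^'d \<Rightarrow> real) \<Rightarrow> bool" where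
  "hull_bounded f \<equiv> (\<lambda>\<xi>. indicator K \<xi> * f \<xi>) \<in> borel_measurable borel \<and> (\<exists>B. \<forall>\<xi>\<in>K. \<bar>f \<xi>\<bar> \<le> B)"

lemma compact_hull: "compact K"
  by (simp add: compact_convex_hull finite_imp_compact)

lemma sets_hull [measurable]: "K \<in> sets borel"
  using compact_hull by (intro borel_closed compact_imp_closed)

lemma hull_bounded_continuous:
  assumes "continuous_on K f"
  shows "hull_bounded f"
proof
  show "(\<lambda>\<xi>. indicator K \<xi> * f \<xi>) \<in> borel_measurable borel"
    using borel_measurable_continuous_on_indicator[OF sets_hull assms] by simp
  show "\<exists>B. \<forall>\<xi>\<in>K. \<bar>f \<xi>\<bar> \<le> B"
    using compact_imp_bounded[OF compact_continuous_image[OF assms compact_hull]]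
    by (auto simp: bounded_iff)
qed

lemma dual_weight_le_1:
  assumes "\<xi> \<in> K" "i \<in> {1..n}"
  shows "w \<xi> i \<le> 1"
  using member_le_sum[of i "{1..n}" "w \<xi>"] dual_weight_sums(1,2)[OF partition assms(1)] assms(2) by auto

lemma integrable_weighted:
  assumes f: "hull_bounded f" and i: "i \<in> {1..n}"
  shows "integrable M (\<lambda>\<omega>. w (X \<omega>) i * (indicator K (X \<omega>) * f (X \<omega>)))"
proof -
  interpret prob_space M
    by (rule prob_M)
  have f_meas: "(\<lambda>\<omega>. indicator K (X \<omega>) * f (X \<omega>)) \<in> borel_measurable M"
    using measurable_compose[OF X conjunct1[OF f]] by simp
  have w_meas: "(\<lambda>\<omega>. w (X \<omega>) i) \<in> borel_measurable M"
    using measurable_compose[OF X borel_measurable_dual_weight[OF partition]] by simp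
  obtain B where B: "\<And>\<xi>. \<xi> \<in> K \<Longrightarrow> \<bar>f \<xi>\<bar> \<le> B"
    using f by blast
  have "norm (w (X \<omega>) i * (indicator K (X \<omega>) * f (X \<omega>))) \<le> \<bar>B\<bar>" for \<omega>
  proof (cases "X \<omega> \<in> K")
    case True
    have "\<bar>w (X \<omega>) i\<bar> * \<bar>f (X \<omega>)\<bar> \<le> 1 * B"
      using dual_weight_le_1[OF True i] dual_weight_sums(1)[OF partition True i] B[OF True]
      by (intro mult_mono) auto
    then show ?thesis
      using True by (simp add: abs_mult)
  qed simp
  then show ?thesis
    by (intro integrable_const_bound[of _ "\<bar>B\<bar>"] AE_I2 borel_measurable_times w_meas f_meas)
qed

text \<open>Integrating out \<open>\<omega>\<^sub>0\<close> first turns the slot indicators into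
  weights. The two arguments of \<open>\<Phi>\<close> cover \<open>F (X)\<close>, \<open>F\<close>
  of the quantizer and the squared error at once; as the quantizer almost surely takes grid values,
  conditions are needed only on the sections at the points \<open>x i\<close>.\<close>

lemma product_expectation_eq:
  assumes \<Phi>: "\<And>i. i \<in> {1..n} \<Longrightarrow> hull_bounded (\<lambda>\<xi>. \<Phi> \<xi> (x i))"
  shows "product_expectation M (\<lambda>\<omega>. \<Phi> (X (snd \<omega>)) (dual_quantization x n C X \<omega>))
           = (\<Sum>i=1..n. \<integral>\<omega>. w (X \<omega>) i * (indicator K (X \<omega>) * \<Phi> (X \<omega>) (x i)) \<partial>M)"
proof -
  interpret M: prob_space M
    by (rule prob_M)
  interpret U: prob_space unit_space
    by (rule prob_space_unit_space)
  interpret pair_prob_space unit_space M ..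
  let ?P = "unit_space \<Otimes>\<^sub>M M"
  define g where "g i \<omega> = indicator K (X \<omega>) * \<Phi> (X \<omega>) (x i)" for i \<omega>
  define h where "h i u \<omega> = indicator (dual_slot x n C (X \<omega>) i) u * g i \<omega>" for i u \<omega>
  have g [measurable]: "g i \<in> borel_measurable M" if "i \<in> {1..n}" for i
    using measurable_compose[OF X conjunct1[OF \<Phi>[OF that]]] by (simp add: g_def[abs_def])
  have w [measurable]: "(\<lambda>\<omega>. w (X \<omega>) j) \<in> borel_measurable M" for j
    using measurable_compose[OF X borel_measurable_dual_weight[OF partition]] by simp
  have fst [measurable]: "fst \<in> borel_measurable ?P"
    using measurable_compose[OF measurable_fst measurable_unit_space] .
  have h [measurable]: "(\<lambda>(u, \<omega>). h i u \<omega>) \<in> borel_measurable ?P" if [measurable]: "i \<in> {1..n}" for i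
    unfolding h_def dual_slot_def indicator_def [of "{_..<_}"] atLeastLessThan_iff case_prod_beta
    by measurable
  have int: "integrable ?P (\<lambda>(u, \<omega>). h i u \<omega>)" if i: "i \<in> {1..n}" for i
  proof -
    obtain B where B: "\<And>\<xi>. \<xi> \<in> K \<Longrightarrow> \<bar>\<Phi> \<xi> (x i)\<bar> \<le> B"
      using \<Phi>[OF i] by blast
    have "\<bar>h i u \<omega>\<bar> \<le> \<bar>B\<bar>" for u \<omega>
      using B[of "X \<omega>"] by (auto simp: h_def g_def indicator_def)
    then show ?thesis
      using h[OF i] by (intro integrable_const_bound[of _ "\<bar>B\<bar>"]) auto
  qed
  \<comment> \<open>Off the hull both sides vanish through the indicator contained in
    \<open>g\<close>.\<close>
  have slot: "(\<integral>u. h i u \<omega> \<partial>unit_space) = w (X \<omega>) i * g i \<omega>" if i: "i \<in> {1..n}" for i \<omega>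
    using integral_dual_slot[OF partition _ i, of "X \<omega>"] by (cases "X \<omega> \<in> K") (auto simp: h_def g_def)
  have ae: "AE z in ?P. (0 \<le> fst z \<and> fst z < 1) \<and> X (snd z) \<in> K"
  proof (rule AE_pair_measure)
    show "AE u in unit_space. AE \<omega> in M. (0 \<le> fst (u, \<omega>) \<and> fst (u, \<omega>) < 1) \<and> X (snd (u, \<omega>)) \<in> K"
      using AE_unit_space by eventually_elim (use X_in_hull in auto)
  qed measurable
  then have eq: "AE z in ?P. \<Phi> (X (snd z)) (dual_quantization x n C X z) = (\<Sum>i=1..n. h i (fst z) (snd z))"
  proof eventually_elim
    case (elim z)
    then show ?case
      using dual_quantizer_sum[OF partition, of "X (snd z)" "fst z" "\<Phi> (X (snd z))"]
      by (simp add: dual_quantization_def case_prod_beta h_def g_def)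
  qed
  have meas: "(\<lambda>z. \<Sum>i=1..n. h i (fst z) (snd z)) \<in> borel_measurable ?P"
    using h by (intro borel_measurable_sum) (simp add: case_prod_beta)
  \<comment> \<open>The original integrand is known to be measurable only for the completion, as it
    is almost everywhere equal to the finite sum. That sum is measurable for the product itself, so
    the completion can then be dropped.\<close>
  have "product_expectation M (\<lambda>\<omega>. \<Phi> (X (snd \<omega>)) (dual_quantization x n C X \<omega>))
          = (\<integral>z. (\<Sum>i=1..n. h i (fst z) (snd z)) \<partial>completion ?P)"
    unfolding product_expectation_def product_space_def
  proof (rule integral_cong_AE)
    show "(\<lambda>z. \<Sum>i=1..n. h i (fst z) (snd z)) \<in> borel_measurable (completion ?P)"
      by (rule measurable_completion[OF meas])
    then show "(\<lambda>z. \<Phi> (X (snd z)) (dual_quantization x n C X z)) \<in> borel_measurable (completion ?P)"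
      by (rule borel_measurable_completion_AE[OF _ AE_completion[OF eq]])
    show "AE z in completion ?P. \<Phi> (X (snd z)) (dual_quantization x n C X z) = (\<Sum>i=1..n. h i (fst z) (snd z))"
      by (rule AE_completion[OF eq])
  qed
  also have "\<dots> = (\<integral>z. (\<Sum>i=1..n. h i (fst z) (snd z)) \<partial>?P)"
    by (rule integral_completion[OF meas])
  also have "\<dots> = (\<Sum>i=1..n. \<integral>(u, \<omega>). h i u \<omega> \<partial>?P)"
    using Bochner_Integration.integral_sum[OF int] by (simp only: case_prod_beta')
  also have "\<dots> = (\<Sum>i=1..n. \<integral>\<omega>. w (X \<omega>) i * g i \<omega> \<partial>M)"
    by (intro sum.cong refl) (simp only: integral_snd[OF int, symmetric] slot)
  finally show ?thesis
    by (simp add: g_def)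
qed

text \<open>Distributing the integrand over the weights, whose sum is one, puts it in the same form
  as the expectations involving the quantizer, ready for termwise comparison.\<close>

lemma product_expectation_of_X:
  assumes "hull_bounded f"
  shows "product_expectation M (\<lambda>\<omega>. f (X (snd \<omega>)))
           = (\<Sum>i=1..n. \<integral>\<omega>. w (X \<omega>) i * (indicator K (X \<omega>) * f (X \<omega>)) \<partial>M)"
  using product_expectation_eq[of "\<lambda>\<xi> y. f \<xi>"] assms by simp

lemma hull_bounded_const: "hull_bounded (\<lambda>\<xi>. c)"
  by (rule hull_bounded_continuous) (rule continuous_on_const)

lemma expectation_F_quantization:
  "product_expectation M (\<lambda>\<omega>. F (dual_quantization x n C X \<omega>))
     = (\<Sum>i=1..n. \<integral>\<omega>. w (X \<omega>) i * (indicator K (X \<omega>) * F (x i)) \<partial>M)"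
  using product_expectation_eq[of "\<lambda>\<xi> y. F y"] hull_bounded_const by simp

section \<open>The cubature formula and the companion interpolation\<close>

text \<open>The probability is the expectation of the indicator of \<open>{x i}\<close> at the
  quantizer. Since the grid points are distinct, only the \<open>i\<close>-th term survives.\<close>

lemma measure_dual_quantization_eq:
  assumes inj: "inj_on x {1..n}" and i: "i \<in> {1..n}"
  shows "measure (product_space M) {\<omega> \<in> space (product_space M). dual_quantization x n C X \<omega> = x i}
           = (\<integral>\<omega>. w (X \<omega>) i * indicator K (X \<omega>) \<partial>M)"
proof -
  let ?E = "{\<omega> \<in> space (product_space M). dual_quantization x n C X \<omega> = x i}"
  have E: "?E \<in> sets (product_space M)"
    using measurable_sets[OF borel_measurable_dual_quantization[OF partition X], of "{x i}"]
    by (simp add: vimage_def Int_def conj_commute)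
  have "measure (product_space M) ?E = (\<integral>z. indicator ?E z \<partial>completion (product_space M))"
    using E by (simp add: Int_absorb2 sets.sets_into_space)
  also have "\<dots> = product_expectation M (\<lambda>\<omega>. indicator {x i} (dual_quantization x n C X \<omega>))"
    unfolding product_expectation_def
    by (intro Bochner_Integration.integral_cong) (auto simp: indicator_def)
  also have "\<dots> = (\<Sum>j=1..n. \<integral>\<omega>. w (X \<omega>) j * (indicator K (X \<omega>) * indicator {x i} (x j)) \<partial>M)"
    by (rule expectation_F_quantization)
  also have "\<dots> = (\<Sum>j=1..n. if j = i then \<integral>\<omega>. w (X \<omega>) i * indicator K (X \<omega>) \<partial>M else 0)"
    using inj i by (intro sum.cong) (auto simp: inj_on_eq_iff)
  finally show ?thesis
    using i by simp
qed

lemma cubature_formula: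
  assumes inj: "inj_on x {1..n}"
  shows "product_expectation M (\<lambda>\<omega>. F (dual_quantization x n C X \<omega>))
           = (\<Sum>i=1..n. measure (product_space M)
                {\<omega> \<in> space (product_space M). dual_quantization x n C X \<omega> = x i} * F (x i))"
  unfolding expectation_F_quantization
proof (intro sum.cong refl)
  fix i assume i: "i \<in> {1..n}"
  show "(\<integral>\<omega>. w (X \<omega>) i * (indicator K (X \<omega>) * F (x i)) \<partial>M)
          = measure (product_space M)
              {\<omega> \<in> space (product_space M). dual_quantization x n C X \<omega> = x i} * F (x i)"
    unfolding measure_dual_quantization_eq[OF inj i] mult.assoc[symmetric]
    by (rule integral_mult_left_zero)
qed

text \<open>On the hull the interpolant is the weighted sum of the grid values. The weights sum to
  one, so distributing the interpolant over them gives the same total integrand as the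
  quantizer.\<close>

lemma expectation_companion_interpolation:
  "product_expectation M (\<lambda>\<omega>. companion_interpolation x n C F (X (snd \<omega>)))
     = product_expectation M (\<lambda>\<omega>. F (dual_quantization x n C X \<omega>))"
proof -
  let ?J = "companion_interpolation x n C F"
  have bounded: "hull_bounded ?J"
  proof
    have "(\<lambda>\<xi>. indicator K \<xi> * ?J \<xi>) = (\<lambda>\<xi>. indicator K \<xi> * (\<Sum>i=1..n. w \<xi> i * F (x i)))"
      by (auto simp: fun_eq_iff indicator_def companion_interpolation_eq[OF partition])
    also have "\<dots> \<in> borel_measurable borel"
      using borel_measurable_dual_weight[OF partition] sets_hull
      by (intro borel_measurable_times borel_measurable_sum borel_measurable_const
          borel_measurable_indicator)
    finally show "(\<lambda>\<xi>. indicator K \<xi> * ?J \<xi>) \<in> borel_measurable borel" .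
    have "\<bar>?J \<xi>\<bar> \<le> (\<Sum>i=1..n. \<bar>F (x i)\<bar>)" if \<xi>: "\<xi> \<in> K" for \<xi>
    proof -
      have "\<bar>?J \<xi>\<bar> \<le> (\<Sum>i=1..n. \<bar>w \<xi> i * F (x i)\<bar>)"
        unfolding companion_interpolation_eq[OF partition \<xi>] by (rule sum_abs)
      also have "\<dots> \<le> (\<Sum>i=1..n. \<bar>F (x i)\<bar>)"
        using dual_weight_le_1[OF \<xi>] dual_weight_sums(1)[OF partition \<xi>]
        by (intro sum_mono) (auto simp: abs_mult intro: mult_left_le_one_le)
      finally show ?thesis .
    qed
    then show "\<exists>B. \<forall>\<xi>\<in>K. \<bar>?J \<xi>\<bar> \<le> B"
      by blast
  qed
  have "(\<Sum>i=1..n. w \<xi> i * (indicator K \<xi> * ?J \<xi>)) = (\<Sum>i=1..n. w \<xi> i * (indicator K \<xi> * F (x i)))" for \<xi>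
  proof (cases "\<xi> \<in> K")
    case True
    then show ?thesis
      using dual_weight_sums(2)[OF partition True]
      by (simp add: sum_distrib_right[symmetric] companion_interpolation_eq[OF partition])
  qed simp
  then show ?thesis
    unfolding product_expectation_of_X[OF bounded] expectation_F_quantization
    using integrable_weighted[OF bounded] integrable_weighted[OF hull_bounded_const]
    by (simp only: Bochner_Integration.integral_sum[symmetric])
qed

section \<open>The error estimate\<close>

lemma cubature_error:
  assumes N: "is_norm N"
    and diff: "\<And>\<xi>. \<xi> \<in> K \<Longrightarrow> F differentiable at \<xi>"
    and lip: "\<And>k. \<exists>L. L-lipschitz_on K (partial_derivative F k)"
  shows "\<bar>product_expectation M (\<lambda>\<omega>. F (X (snd \<omega>)))
            - product_expectation M (\<lambda>\<omega>. F (dual_quantization x n C X \<omega>))\<bar>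
         \<le> differential_Lip N K F
            * product_expectation M (\<lambda>\<omega>. (N (X (snd \<omega>) - dual_quantization x n C X \<omega>))\<^sup>2)"
proof -
  let ?L = "differential_Lip N K F"
  have "continuous_on K F"
    using diff by (intro continuous_at_imp_continuous_on ballI differentiable_imp_continuous_within)
  then have F: "hull_bounded F"
    by (rule hull_bounded_continuous)
  have "continuous_on K (\<lambda>\<xi>. (N (\<xi> - x i))\<^sup>2)" for i
    by (intro continuous_intros continuous_on_compose2[OF continuous_on_is_norm[OF N, of UNIV]]) auto
  then have Q: "hull_bounded (\<lambda>\<xi>. (N (\<xi> - x i))\<^sup>2)" for i
    by (rule hull_bounded_continuous)
  \<comment> \<open>\<open>f\<close> and \<open>q\<close> are the \<open>i\<close>-th contributions
    to the cubature error and to the quadratic quantization error, each cut off outside the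
    hull.\<close>
  define f where "f i \<xi> = w \<xi> i * (indicator K \<xi> * F \<xi>) - w \<xi> i * (indicator K \<xi> * F (x i))" for i \<xi>
  define q where "q i \<xi> = w \<xi> i * (indicator K \<xi> * (N (\<xi> - x i))\<^sup>2)" for i \<xi>
  have f_int: "integrable M (\<lambda>\<omega>. f i (X \<omega>))" if "i \<in> {1..n}" for i
    unfolding f_def using that
    by (intro Bochner_Integration.integrable_diff integrable_weighted F hull_bounded_const)
  have q_int: "integrable M (\<lambda>\<omega>. q i (X \<omega>))" if "i \<in> {1..n}" for i
    unfolding q_def using that by (intro integrable_weighted Q)
  have pointwise: "\<bar>\<Sum>i=1..n. f i \<xi>\<bar> \<le> ?L * (\<Sum>i=1..n. q i \<xi>)" for \<xi>
  proof (cases "\<xi> \<in> K")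
    case True
    note w = dual_weight_sums[OF partition True]
    define D where "D = frechet_derivative F (at \<xi>)"
    have "linear D"
      unfolding D_def by (intro linear_frechet_derivative diff True)
    then have "(\<Sum>i=1..n. w \<xi> i * D (x i - \<xi>)) = D (\<Sum>i=1..n. w \<xi> i *\<^sub>R (x i - \<xi>))"
      by (simp add: linear_sum linear_cmul)
    \<comment> \<open>Barycentre \<open>\<xi>\<close> and total mass one cancel: the quantizer
      preserves \<open>\<xi>\<close> in the mean, so the first-order term disappears and the error
      is quadratic.\<close>
    also have "(\<Sum>i=1..n. w \<xi> i *\<^sub>R (x i - \<xi>)) = 0"
      unfolding scaleR_diff_right sum_subtractf w(3) scaleR_left.sum[symmetric] w(2) by simp
    finally have D0: "(\<Sum>i=1..n. w \<xi> i * D (x i - \<xi>)) = 0"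
      by (simp add: linear_0[OF \<open>linear D\<close>])
    have "(\<Sum>i=1..n. f i \<xi>) = - (\<Sum>i=1..n. w \<xi> i * (F (x i) - F \<xi> - D (x i - \<xi>)))"
      using True D0 by (simp add: f_def algebra_simps sum.distrib sum_subtractf)
    then have "\<bar>\<Sum>i=1..n. f i \<xi>\<bar> \<le> (\<Sum>i=1..n. \<bar>w \<xi> i * (F (x i) - F \<xi> - D (x i - \<xi>))\<bar>)"
      using sum_abs[of "\<lambda>i. w \<xi> i * (F (x i) - F \<xi> - D (x i - \<xi>))"] by simp
    also have "\<dots> \<le> (\<Sum>i=1..n. w \<xi> i * (?L * (N (\<xi> - x i))\<^sup>2))"
    proof (intro sum_mono)
      fix i assume i: "i \<in> {1..n}"
      have "\<bar>F (x i) - F \<xi> - D (x i - \<xi>)\<bar> \<le> ?L * (N (\<xi> - x i))\<^sup>2"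
        unfolding D_def using i True
        by (intro taylor_differential_Lip N convex_convex_hull diff lip) (auto intro: hull_inc)
      then show "\<bar>w \<xi> i * (F (x i) - F \<xi> - D (x i - \<xi>))\<bar> \<le> w \<xi> i * (?L * (N (\<xi> - x i))\<^sup>2)"
        using w(1)[OF i] by (simp add: abs_mult mult_left_mono)
    qed
    finally show ?thesis
      using True by (simp add: q_def sum_distrib_left mult.left_commute)
  qed (simp add: f_def q_def)
  have "product_expectation M (\<lambda>\<omega>. F (X (snd \<omega>)))
            - product_expectation M (\<lambda>\<omega>. F (dual_quantization x n C X \<omega>))
          = (\<Sum>i=1..n. \<integral>\<omega>. f i (X \<omega>) \<partial>M)"
    unfolding product_expectation_of_X[OF F] expectation_F_quantization sum_subtractf[symmetric] f_def
    by (intro sum.cong refl Bochner_Integration.integral_diff[symmetric] integrable_weighted F hull_bounded_const)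
  also have "\<dots> = (\<integral>\<omega>. (\<Sum>i=1..n. f i (X \<omega>)) \<partial>M)"
    by (rule Bochner_Integration.integral_sum[OF f_int, symmetric])
  also have "\<bar>\<dots>\<bar> \<le> (\<integral>\<omega>. \<bar>\<Sum>i=1..n. f i (X \<omega>)\<bar> \<partial>M)"
    by (rule integral_abs_bound)
  also have "\<dots> \<le> (\<integral>\<omega>. ?L * (\<Sum>i=1..n. q i (X \<omega>)) \<partial>M)"
    by (intro integral_mono pointwise integrable_abs integrable_mult_right
        Bochner_Integration.integrable_sum f_int q_int)
  also have "\<dots> = ?L * (\<Sum>i=1..n. \<integral>\<omega>. q i (X \<omega>) \<partial>M)"
    by (simp only: integral_mult_right_zero Bochner_Integration.integral_sum[OF q_int])
  also have "(\<Sum>i=1..n. \<integral>\<omega>. q i (X \<omega>) \<partial>M)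
      = product_expectation M (\<lambda>\<omega>. (N (X (snd \<omega>) - dual_quantization x n C X \<omega>))\<^sup>2)"
    unfolding q_def by (rule product_expectation_eq[symmetric]) (rule Q)
  finally show ?thesis .
qed

end

theorem proposition9:
  fixes N :: "real^'d \<Rightarrow> real" and p :: real
    and M :: "'w measure" and X :: "'w \<Rightarrow> real^'d"
    and n :: nat and x :: "nat \<Rightarrow> real^'d"
    and C :: "nat set \<Rightarrow> (real^'d) set"
    and F :: "real^'d \<Rightarrow> real" and V :: "(real^'d) set"
  assumes "is_norm N" and "1 \<le> p"
    and "prob_space M" and "X \<in> borel_measurable M"
    and "compact (measure_support (distr M borel X))"
    and "inj_on x {1..n}"
    and "affine hull (x ` {1..n}) = UNIV"
    and "measure_support (distr M borel X) \<subseteq> convex hull (x ` {1..n})"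
    and "is_dual_partition N p x n C"
    and "open V" and "convex hull (x ` {1..n}) \<subseteq> V" and "F differentiable_on V"
    and "\<And>k. \<exists>L. L-lipschitz_on (convex hull (x ` {1..n})) (partial_derivative F k)"
  shows "product_expectation M (\<lambda>\<omega>. F (dual_quantization x n C X \<omega>)) =
           (\<Sum>i=1..n. measure (product_space M)
                        {\<omega> \<in> space (product_space M). dual_quantization x n C X \<omega> = x i} * F (x i))
       \<and> \<bar>product_expectation M (\<lambda>\<omega>. F (X (snd \<omega>)))
            - product_expectation M (\<lambda>\<omega>. companion_interpolation x n C F (X (snd \<omega>)))\<bar>
         = \<bar>product_expectation M (\<lambda>\<omega>. F (X (snd \<omega>)))
            - product_expectation M (\<lambda>\<omega>. F (dual_quantization x n C X \<omega>))\<bar>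
       \<and> \<bar>product_expectation M (\<lambda>\<omega>. F (X (snd \<omega>)))
            - product_expectation M (\<lambda>\<omega>. F (dual_quantization x n C X \<omega>))\<bar>
         \<le> differential_Lip N (convex hull (x ` {1..n})) F
            * product_expectation M (\<lambda>\<omega>. (N (X (snd \<omega>) - dual_quantization x n C X \<omega>))\<^sup>2)"
proof -
  have supp: "AE z in distr M borel X. z \<in> measure_support (distr M borel X)"
    by (rule AE_measure_support) simp
  have "AE \<omega> in M. X \<omega> \<in> measure_support (distr M borel X)"
    by (rule AE_distrD[OF assms(4) supp])
  \<comment> \<open>Almost sure membership in the hull is the form in which the support hypothesis
    enters the integrals.\<close>
  then have "AE \<omega> in M. X \<omega> \<in> convex hull (x ` {1..n})"
    by eventually_elim (use assms(8) in blast)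
  with assms(3,4,9) interpret dual_quantization_setup N p x n C M X
    by (intro dual_quantization_setup.intro)
  \<comment> \<open>Openness of \<open>V\<close> turns differentiability within \<open>V\<close>
    into differentiability in the full space, including at boundary points of the hull.\<close>
  have "F differentiable at \<xi>" if "\<xi> \<in> convex hull (x ` {1..n})" for \<xi>
    using assms(10-12) that by (auto simp: differentiable_on_eq_differentiable_at)
  then show ?thesis
    using cubature_formula[OF assms(6)] cubature_error[OF assms(1) _ assms(13)]
    by (simp add: expectation_companion_interpolation)
qed

end
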